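(* Let $M,N\ge 1$, $\sigma_x^2,\sigma_n^2>0$, $m_{min}=\lceil M/N\rceil$, and let $m_{max}$ be an integer with $m_{min}\le m_{max}\le M$. Consider tight fusion frames $\{\mathcal{W}_i\}_{i=1}^N$ for $\mathbb{R}^M$ whose subspaces have dimensions $1\le m_i\le m_{max}$, and let $MSE_{\{i\}}$ denote the mean-squared error of the no-erasure LMMSE filter when the single subspace $\mathcal{W}_i$ is erased (signal covariance $\sigma_x^2\mathbf{I}$, noise covariance $\sigma_n^2\mathbf{I}$). Define, for real $m> -\frac{M\sigma_n^2}{N\sigma_x^2}$, $$MSE(m)=\frac{M\sigma_x^2\sigma_n^2}{Nm\sigma_x^2/M+\sigma_n^2}+\frac{\sigma_x^4(\sigma_x^2+\sigma_n^2)\,m}{(Nm\sigma_x^2/M+\sigma_n^2)^2},$$ and let $$\tilde m=\frac{M}{N}\cdot\frac{\sigma_x^2\sigma_n^2-(N-1)\sigma_n^4}{\sigma_x^2\left((N+1)\sigma_n^2+\sigma_x^2\right)},$$ which is the point at which $MSE(m)$ attains its maximum. Set $$m^\ast=\begin{cases} m_{min}, & \text{if } m_{max}\le\tilde m,\ \text{or if } m_{min}\le\tilde m\le m_{max}\text{ and } MSE(m_{min})\le MSE(m_{max}),\\ m_{max}, & \text{otherwise.}\end{cases}$$ Then the MSE due to the erasure of one subspace is minimized when all subspaces have equal dimension $m^\ast$. That is, if $\{\mathcal{W}_i^\ast\}_{i=1}^N$ is a tight fusion frame for $\mathbb{R}^M$ with $\dim\mathcal{W}_i^\ast=m^\ast$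 for all $i$, then for every tight fusion frame $\{\mathcal{W}_i\}_{i=1}^N$ for $\mathbb{R}^M$ with all dimensions in $\{1,\dots,m_{max}\}$, the value $\max_{1\le i\le N}MSE_{\{i\}}$ for $\{\mathcal{W}_i^\ast\}$ is at most the value $\max_{1\le i\le N}MSE_{\{i\}}$ for $\{\mathcal{W}_i\}$.
   Context: A tight fusion frame for $\mathbb{R}^M$ is a finite collection of subspaces $\{\mathcal{W}_i\}_{i=1}^N$ of $\mathbb{R}^M$ whose orthogonal projections $\mathbf{P}_i$ satisfy $\sum_{i=1}^N\mathbf{P}_i=A\,\mathbf{I}$ for some $A>0$. Measurement model: $\mathbf{x}$ is a zero-mean random vector in $\mathbb{R}^M$ with $\mathbf{R}_{xx}=E[\mathbf{x}\mathbf{x}^T]=\sigma_x^2\mathbf{I}$; $\mathbf{z}_i=\mathbf{P}_i\mathbf{x}+\mathbf{n}_i$, $i=1,\dots,N$, where the noise vectors $\mathbf{n}_i$ are mutually uncorrelated, uncorrelated with $\mathbf{x}$, and $E[\mathbf{n}_i\mathbf{n}_i^T]=\sigma_n^2\mathbf{I}$. Put $\mathbf{z}=(\mathbf{z}_1^T,\dots,\mathbf{z}_N^T)^T\in\mathbb{R}^{NM}$. The (no-erasure) LMMSE filter is $\mathbf{F}=\mathbf{R}_{xz}\mathbf{R}_{zz}^{-1}$, with $\mathbf{R}_{xz}=E[\mathbf{x}\mathbf{z}^T]$ and $\mathbf{R}_{zz}=E[\mathbf{z}\mathbf{z}^T]$. Erasures: for a set $\mathbb{S}\subset\{1,\dots,N\}$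 of erased indices, let $\mathbf{E}$ be the $NM\times NM$ block-diagonal matrix whose $i$th $M\times M$ diagonal block is $\mathbf{I}$ if $i\in\mathbb{S}$ and $\mathbf{0}$ otherwise. The signal is estimated by $\tilde{\mathbf{x}}=\mathbf{F}(\mathbf{I}-\mathbf{E})\mathbf{z}$ (the filter $\mathbf{F}$ is not recomputed), and the MSE under erasure of $\mathbb{S}$ is $MSE_{\mathbb{S}}=\mathrm{tr}\,E[(\mathbf{x}-\tilde{\mathbf{x}})(\mathbf{x}-\tilde{\mathbf{x}})^T]$. The integer $m_{max}$ is the prescribed maximum allowable subspace dimension. Since any of the subspaces may be the erased one, the MSE due to one erasure is understood as the largest value over the choice of the erased subspace. *)

theory Defs
  imports "HOL-Probability.Probability"
begin

text \<open>
  The ambient space is \<open>real^'m\<close> with \<open>CARD('m) = M\<close>, the subspaces are indexed by a finite type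
  \<open>'n\<close> with \<open>CARD('n) = N\<close>, and the stacked measurement space is \<open>real^('n \<times> 'm)\<close>, whose
  coordinate \<open>(i, k)\<close> is coordinate \<open>k\<close> of block \<open>i\<close>.
\<close>

definition orth_proj :: "(real^'m) set \<Rightarrow> real^'m^'m" where
  "orth_proj W =
     (THE P. \<forall>v. P *v v \<in> W \<and> (\<forall>w\<in>W. orthogonal (v - P *v v) w))"

lemma orth_proj_unique:
  fixes W :: "(real^'m) set"
  assumes W: "subspace W"
  shows "\<exists>!P::real^'m^'m. \<forall>v. P *v v \<in> W \<and> (\<forall>w\<in>W. orthogonal (v - P *v v) w)"
proof -
  have uniq: "a = b"
    if "a \<in> W" "b \<in> W" "\<forall>w\<in>W. orthogonal (v - a) w" "\<forall>w\<in>W. orthogonal (v - b) w" for a b v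
  proof -
    have "a - b \<in> W" using that W by (simp add: subspace_diff)
    then have "(v - a) \<bullet> (a - b) = 0" "(v - b) \<bullet> (a - b) = 0"
      using that by (auto simp: orthogonal_def)
    then have "(a - b) \<bullet> (a - b) = 0"
      by (simp add: inner_diff_left)
    then show ?thesis by simp
  qed
  have "\<exists>y. y \<in> W \<and> (\<forall>w\<in>W. orthogonal (v - y) w)" for v
  proof -
    obtain y z where "y \<in> span W" "\<And>w. w \<in> span W \<Longrightarrow> orthogonal z w" "v = y + z"
      using orthogonal_subspace_decomp_exists by metis
    then show ?thesis using W by (intro exI[of _ y]) (auto simp: span_eq_iff[THEN iffD2])
  qed
  then obtain p where p: "\<And>v. p v \<in> W" "\<And>v w. w \<in> W \<Longrightarrow> orthogonal (v - p v) w"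
    by metis
  have "linear p"
  proof
    fix u v :: "real^'m" and c :: real
    show "p (u + v) = p u + p v"
    proof (rule uniq[of _ _ "u + v"])
      show "\<forall>w\<in>W. orthogonal (u + v - (p u + p v)) w"
        using p(2)[of _ u] p(2)[of _ v]
        by (auto simp: orthogonal_def inner_diff_left inner_add_left)
    qed (use p W in \<open>auto simp: subspace_add\<close>)
    show "p (c *\<^sub>R v) = c *\<^sub>R p v"
    proof (rule uniq[of _ _ "c *\<^sub>R v"])
      show "\<forall>w\<in>W. orthogonal (c *\<^sub>R v - c *\<^sub>R p v) w"
        using p(2)[of _ v] by (auto simp: orthogonal_def inner_diff_left)
    qed (use p W in \<open>auto simp: subspace_scale\<close>)
  qed
  then have mp: "matrix p *v v = p v" for v by (simp add: matrix_works)
  show ?thesis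
  proof (rule ex1I[of _ "matrix p"])
    show "\<forall>v. matrix p *v v \<in> W \<and> (\<forall>w\<in>W. orthogonal (v - matrix p *v v) w)"
      using p by (simp add: mp)
  next
    fix P :: "real^'m^'m"
    assume "\<forall>v. P *v v \<in> W \<and> (\<forall>w\<in>W. orthogonal (v - P *v v) w)"
    then have "P *v v = matrix p *v v" for v
      using uniq[of "P *v v" "p v" v] p mp by simp
    then show "P = matrix p" by (simp add: matrix_eq)
  qed
qed

definition tight_fusion_frame :: "('n::finite \<Rightarrow> (real^'m) set) \<Rightarrow> bool" where
  "tight_fusion_frame W \<longleftrightarrow>
     (\<forall>i. subspace (W i)) \<and> (\<exists>A>0. (\<Sum>i\<in>UNIV. orth_proj (W i)) = A *\<^sub>R mat 1)"

definition outer :: "real^'a \<Rightarrow> real^'b \<Rightarrow> real^'b^'a" where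
  "outer u v = (\<chi> i j. u $ i * v $ j)"

definition cross_corr :: "'w measure \<Rightarrow> ('w \<Rightarrow> real^'a) \<Rightarrow> ('w \<Rightarrow> real^'b) \<Rightarrow> real^'b^'a" where
  "cross_corr \<Omega> X Y = (\<integral>\<omega>. outer (X \<omega>) (Y \<omega>) \<partial>\<Omega>)"

definition sq_integrable_rv :: "'w measure \<Rightarrow> ('w \<Rightarrow> real^'a) \<Rightarrow> bool" where
  "sq_integrable_rv \<Omega> X \<longleftrightarrow>
     X \<in> borel_measurable \<Omega> \<and> integrable \<Omega> (\<lambda>\<omega>. (norm (X \<omega>))\<^sup>2)"

text \<open>
  Square integrability is what makes the second-moment matrices meaningful; the Bochner integral
  of a non-integrable function is 0. Since the signal has mean zero, a vanishing cross-correlation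
  of signal and noise is the same as a vanishing covariance. For two noise vectors it is the same
  whenever the noise has mean zero, that is, whenever \<open>E[n\<^sub>i n\<^sub>i\<^sup>T]\<close> is the noise covariance; the
  mean of the noise is not used otherwise and is left out.
\<close>

definition measurement_model ::
    "'w measure \<Rightarrow> real \<Rightarrow> real \<Rightarrow> ('w \<Rightarrow> real^'m) \<Rightarrow> ('n::finite \<Rightarrow> 'w \<Rightarrow> real^'m) \<Rightarrow> bool" where
  "measurement_model \<Omega> \<sigma>x \<sigma>n x n \<longleftrightarrow>
     prob_space \<Omega> \<and>
     sq_integrable_rv \<Omega> x \<and> (\<forall>i. sq_integrable_rv \<Omega> (n i)) \<and>
     (\<integral>\<omega>. x \<omega> \<partial>\<Omega>) = 0 \<and>
     cross_corr \<Omega> x x = \<sigma>x\<^sup>2 *\<^sub>R mat 1 \<and>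
     (\<forall>i. cross_corr \<Omega> (n i) (n i) = \<sigma>n\<^sup>2 *\<^sub>R mat 1) \<and>
     (\<forall>i j. i \<noteq> j \<longrightarrow> cross_corr \<Omega> (n i) (n j) = 0) \<and>
     (\<forall>i. cross_corr \<Omega> x (n i) = 0)"

definition measurement ::
    "('n::finite \<Rightarrow> (real^'m) set) \<Rightarrow> ('w \<Rightarrow> real^'m) \<Rightarrow> ('n \<Rightarrow> 'w \<Rightarrow> real^'m) \<Rightarrow>
     'w \<Rightarrow> real^('n \<times> 'm)" where
  "measurement W x n \<omega> =
     (\<chi> p. (orth_proj (W (fst p)) *v x \<omega> + n (fst p) \<omega>) $ snd p)"

definition lmmse_filter ::
    "'w measure \<Rightarrow> ('w \<Rightarrow> real^'m) \<Rightarrow> ('w \<Rightarrow> real^'k) \<Rightarrow> real^'k^'m" where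
  "lmmse_filter \<Omega> x z = cross_corr \<Omega> x z ** matrix_inv (cross_corr \<Omega> z z)"

definition erasure_matrix :: "'n::finite set \<Rightarrow> real^('n \<times> 'm::finite)^('n \<times> 'm)" where
  "erasure_matrix S = (\<chi> p q. if p = q \<and> fst p \<in> S then 1 else 0)"

definition erasure_estimate ::
    "'w measure \<Rightarrow> ('n::finite \<Rightarrow> (real^'m) set) \<Rightarrow> ('w \<Rightarrow> real^'m) \<Rightarrow> ('n \<Rightarrow> 'w \<Rightarrow> real^'m) \<Rightarrow>
     'n set \<Rightarrow> 'w \<Rightarrow> real^'m" where
  "erasure_estimate \<Omega> W x n S \<omega> =
     lmmse_filter \<Omega> x (measurement W x n) *v
       ((mat 1 - erasure_matrix S) *v measurement W x n \<omega>)"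

definition erasure_mse ::
    "'w measure \<Rightarrow> ('n::finite \<Rightarrow> (real^'m) set) \<Rightarrow> ('w \<Rightarrow> real^'m) \<Rightarrow> ('n \<Rightarrow> 'w \<Rightarrow> real^'m) \<Rightarrow>
     'n set \<Rightarrow> real" where
  "erasure_mse \<Omega> W x n S =
     trace (cross_corr \<Omega> (\<lambda>\<omega>. x \<omega> - erasure_estimate \<Omega> W x n S \<omega>)
                         (\<lambda>\<omega>. x \<omega> - erasure_estimate \<Omega> W x n S \<omega>))"

definition one_erasure_mse ::
    "'w measure \<Rightarrow> ('n::finite \<Rightarrow> (real^'m) set) \<Rightarrow> ('w \<Rightarrow> real^'m) \<Rightarrow> ('n \<Rightarrow> 'w \<Rightarrow> real^'m) \<Rightarrow>
     real" where
  "one_erasure_mse \<Omega> W x n = Max (range (\<lambda>i. erasure_mse \<Omega> W x n {i}))"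

definition mse_fun :: "nat \<Rightarrow> nat \<Rightarrow> real \<Rightarrow> real \<Rightarrow> real \<Rightarrow> real" where
  "mse_fun M N \<sigma>x \<sigma>n m =
     (real M * \<sigma>x\<^sup>2 * \<sigma>n\<^sup>2) / (real N * m * \<sigma>x\<^sup>2 / real M + \<sigma>n\<^sup>2)
     + (\<sigma>x ^ 4 * (\<sigma>x\<^sup>2 + \<sigma>n\<^sup>2) * m) / (real N * m * \<sigma>x\<^sup>2 / real M + \<sigma>n\<^sup>2)\<^sup>2"

definition m_tilde :: "nat \<Rightarrow> nat \<Rightarrow> real \<Rightarrow> real \<Rightarrow> real" where
  "m_tilde M N \<sigma>x \<sigma>n =
     real M / real N * ((\<sigma>x\<^sup>2 * \<sigma>n\<^sup>2 - (real N - 1) * \<sigma>n ^ 4)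
                        / (\<sigma>x\<^sup>2 * ((real N + 1) * \<sigma>n\<^sup>2 + \<sigma>x\<^sup>2)))"

definition m_star :: "nat \<Rightarrow> nat \<Rightarrow> real \<Rightarrow> real \<Rightarrow> nat \<Rightarrow> nat \<Rightarrow> nat" where
  "m_star M N \<sigma>x \<sigma>n m_min m_max =
     (if real m_max \<le> m_tilde M N \<sigma>x \<sigma>n \<or>
         (real m_min \<le> m_tilde M N \<sigma>x \<sigma>n \<and> m_tilde M N \<sigma>x \<sigma>n \<le> real m_max \<and>
          mse_fun M N \<sigma>x \<sigma>n (real m_min) \<le> mse_fun M N \<sigma>x \<sigma>n (real m_max))
      then m_min else m_max)"

end

theory Submission
  imports Defs
begin

text \<open>
  Write \<open>a = \<sigma>x\<^sup>2\<close>, \<open>b = \<sigma>n\<^sup>2\<close> and let \<open>A\<close> be the frame bound, \<open>\<Sum>\<^sub>i P\<^sub>i = A I\<close>. Comparing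
  traces shows \<open>A = (\<Sum>\<^sub>i m\<^sub>i) / M\<close>, where \<open>m\<^sub>i\<close> are the dimensions of the subspaces.

  Tightness makes the filter explicit: it is \<open>a / (a A + b)\<close> times the transpose of the stacked
  projections (\<open>lmmse_filter_tight\<close>). Consequently the error after erasing \<open>W\<^sub>i\<close> is a quadratic
  expression in the single projection \<open>P\<^sub>i\<close>, and since \<open>P\<^sub>i\<^sup>2 = P\<^sub>i\<close> and \<open>tr P\<^sub>i = m\<^sub>i\<close>, it equals
  \<open>M a b / (a A + b) + a\<^sup>2 (a + b) m\<^sub>i / (a A + b)\<^sup>2\<close> (\<open>erasure_mse_single\<close>).

  This increases with \<open>m\<^sub>i\<close>, so the worst erasure is that of a subspace of the largest dimension
  \<open>m\<close>. It decreases as \<open>A\<close> grows, and \<open>A \<le> N m / M\<close>; hence the worst error is at least \<open>MSE(m)\<close>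
  (\<open>one_erasure_mse_ge\<close>), with equality for frames of constant dimension. Moreover \<open>A \<ge> 1\<close>, because the
  projection onto a nonzero subspace fixes its vectors; so \<open>N m \<ge> M\<close>, that is, \<open>m \<ge> m_min\<close>.

  It remains to minimize \<open>MSE\<close> over this range. As a function of \<open>t = 1 / (N m a / M + b)\<close> it is a
  concave quadratic polynomial (\<open>mse_fun_vertex_form\<close>) with its vertex at \<open>m_tilde\<close>, so it is
  smallest at one of the two end points, and \<open>m_star\<close> is the better of them
  (\<open>mse_fun_m_star_le\<close>).
\<close>

section \<open>Sums and traces of matrices\<close>

lemma trace_sum:
  fixes f :: "'i \<Rightarrow> real^'m^'m"
  shows "trace (sum f S) = (\<Sum>i\<in>S. trace (f i))"
  by (induction S rule: infinite_finite_induct) (auto simp: trace_add trace_0[simplified])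

lemma matrix_add_rdistrib: "(A + B) ** C = A ** C + B ** C" for A B :: "real^'m^'k"
  by (vector matrix_matrix_mult_def sum.distrib[symmetric] field_simps)

lemma trace_scaleR: "trace (c *\<^sub>R A) = c * trace A" for A :: "real^'m^'m"
  by (simp add: trace_def sum_distrib_left)

lemma sum_matrix_vector_mult:
  fixes f :: "'i \<Rightarrow> real^'m^'k"
  shows "sum f S *v v = (\<Sum>i\<in>S. f i *v v)"
  by (induction S rule: infinite_finite_induct) (auto simp: matrix_vector_mult_add_rdistrib)

section \<open>Orthogonal projections\<close>

lemma orth_proj_props:
  fixes W :: "(real^'m) set"
  assumes "subspace W"
  shows orth_proj_mem: "orth_proj W *v v \<in> W"
    and orth_proj_residual: "w \<in> W \<Longrightarrow> (v - orth_proj W *v v) \<bullet> w = 0"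
  using theI'[OF orth_proj_unique[OF assms]] unfolding orth_proj_def[symmetric]
  by (auto simp: orthogonal_def)

lemma orth_proj_eqI:
  fixes W :: "(real^'m) set"
  assumes "subspace W" "\<And>v. P *v v \<in> W" "\<And>v w. w \<in> W \<Longrightarrow> (v - P *v v) \<bullet> w = 0"
  shows "orth_proj W = P"
  unfolding orth_proj_def
  by (rule the1_equality[OF orth_proj_unique[OF assms(1)]])
     (use assms in \<open>auto simp: orthogonal_def\<close>)

lemma orth_proj_fixes:
  fixes W :: "(real^'m) set"
  assumes "subspace W" "v \<in> W"
  shows "orth_proj W *v v = v"
proof -
  have "v - orth_proj W *v v \<in> W"
    using assms by (simp add: subspace_diff orth_proj_mem)
  from orth_proj_residual[OF assms(1) this, of v] show ?thesis by simp
qed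

lemma orth_proj_idem:
  fixes W :: "(real^'m) set"
  assumes "subspace W"
  shows "orth_proj W ** orth_proj W = orth_proj W"
  by (simp add: matrix_eq matrix_vector_mul_assoc[symmetric] orth_proj_fixes orth_proj_mem assms)

lemma inner_orth_proj:
  fixes W :: "(real^'m) set"
  assumes "subspace W"
  shows "u \<bullet> (orth_proj W *v v) = (orth_proj W *v u) \<bullet> (orth_proj W *v v)"
  using orth_proj_residual[OF assms orth_proj_mem[OF assms, of v], of u]
  by (simp add: inner_diff_left)

lemma orth_proj_sym:
  fixes W :: "(real^'m) set"
  assumes "subspace W"
  shows "transpose (orth_proj W) = orth_proj W"
proof -
  have "u \<bullet> (transpose (orth_proj W) *v v) = u \<bullet> (orth_proj W *v v)" for u v
    using inner_orth_proj[OF assms, of u v] inner_orth_proj[OF assms, of v u]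
    by (simp add: dot_lmul_matrix[symmetric] inner_commute)
  then show ?thesis
    by (metis matrix_eq vector_eq_ldot)
qed

text \<open>
  In an orthonormal basis \<open>B\<close> of \<open>W\<close> the projection is \<open>\<Sum>b\<in>B. b b\<^sup>T\<close>, and each
  rank-one summand has trace \<open>\<parallel>b\<parallel>\<^sup>2 = 1\<close>.
\<close>
lemma trace_orth_proj:
  fixes W :: "(real^'m) set"
  assumes W: "subspace W"
  shows "trace (orth_proj W) = real (dim W)"
proof -
  obtain B where B: "B \<subseteq> W" "pairwise orthogonal B" "\<And>x. x \<in> B \<Longrightarrow> norm x = 1"
    "independent B" "card B = dim W" "span B = W"
    using orthonormal_basis_subspace[OF W] by metis
  have fin: "finite B" using B(4) independent_bound by blast
  define P :: "real^'m^'m" where "P = (\<Sum>b\<in>B. outer b b)"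
  have Pv: "P *v v = (\<Sum>b\<in>B. (v \<bullet> b) *\<^sub>R b)" for v
  proof -
    have "outer b b *v v = (v \<bullet> b) *\<^sub>R b" for b
      by (vector outer_def matrix_vector_mult_def inner_vec_def sum_distrib_left mult_ac)
    then show ?thesis by (simp add: P_def sum_matrix_vector_mult)
  qed
  have "orth_proj W = P"
  proof (rule orth_proj_eqI[OF W])
    show "P *v v \<in> W" for v
      unfolding Pv using B(1) W by (auto intro!: subspace_sum subspace_scale)
    show "(v - P *v v) \<bullet> w = 0" if "w \<in> W" for v w
    proof -
      have "(v - P *v v) \<bullet> c = 0" if c: "c \<in> B" for c
      proof -
        have "(P *v v) \<bullet> c = (\<Sum>b\<in>B. (v \<bullet> b) * (b \<bullet> c))"
          by (simp add: Pv inner_sum_left)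
        also have "\<dots> = (\<Sum>b\<in>B. if b = c then v \<bullet> c else 0)"
          using B(2,3) c
          by (intro sum.cong)
             (auto simp: pairwise_def orthogonal_def dot_square_norm)
        finally show ?thesis using c fin by (simp add: inner_diff_left)
      qed
      then have "orthogonal (v - P *v v) w"
        using orthogonal_to_span[of w B "v - P *v v"] that B(6)
        by (auto simp: orthogonal_def)
      then show ?thesis by (simp add: orthogonal_def)
    qed
  qed
  moreover have "trace (outer b b) = 1" if "b \<in> B" for b
  proof -
    have "trace (outer b b) = b \<bullet> b"
      by (simp add: trace_def outer_def inner_vec_def)
    with B(3)[OF that] show ?thesis by (simp add: dot_square_norm)
  qed
  ultimately show ?thesis using B(5) by (simp add: P_def trace_sum)
qed

section \<open>Second moments\<close>

lemma norm_outer: "norm (outer u v) = norm u * norm v"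
proof -
  have "norm (outer u v) = L2_set (\<lambda>i. \<bar>u $ i\<bar> * norm v) UNIV"
  proof -
    have "outer u v $ i = (u $ i) *\<^sub>R v" for i
      by (vector outer_def)
    then show ?thesis by (simp add: norm_vec_def[of "outer u v"])
  qed
  also have "\<dots> = norm u * norm v"
    by (simp add: L2_set_left_distrib[symmetric] norm_vec_def[of u])
  finally show ?thesis .
qed

lemma outer_measurable:
  assumes "X \<in> borel_measurable \<Omega>" "Y \<in> borel_measurable \<Omega>"
  shows "(\<lambda>\<omega>. outer (X \<omega>) (Y \<omega>)) \<in> borel_measurable \<Omega>"
  by (rule borel_measurable_continuous_Pair[OF assms])
     (unfold outer_def, intro continuous_intros)

lemma integrable_outer:
  fixes X :: "'w \<Rightarrow> real^'b" and Y :: "'w \<Rightarrow> real^'c"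
  assumes "sq_integrable_rv \<Omega> X" "sq_integrable_rv \<Omega> Y"
  shows "integrable \<Omega> (\<lambda>\<omega>. outer (X \<omega>) (Y \<omega>))"
proof (rule Bochner_Integration.integrable_bound)
  show "integrable \<Omega> (\<lambda>\<omega>. (norm (X \<omega>))\<^sup>2 + (norm (Y \<omega>))\<^sup>2)"
    using assms by (auto simp: sq_integrable_rv_def)
  show "(\<lambda>\<omega>. outer (X \<omega>) (Y \<omega>)) \<in> borel_measurable \<Omega>"
    using assms by (auto simp: sq_integrable_rv_def intro: outer_measurable)
  have "norm u * norm v \<le> (norm u)\<^sup>2 + (norm v)\<^sup>2" for u :: "real^'b" and v :: "real^'c"
    using sum_squares_bound[of "norm u" "norm v"] mult_nonneg_nonneg[of "norm u" "norm v"]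
    by (simp del: mult_nonneg_nonneg)
  then show "AE \<omega> in \<Omega>. norm (outer (X \<omega>) (Y \<omega>)) \<le> norm ((norm (X \<omega>))\<^sup>2 + (norm (Y \<omega>))\<^sup>2)"
    by (simp add: norm_outer)
qed

lemma cross_corr_component:
  fixes X :: "'w \<Rightarrow> real^'a" and Y :: "'w \<Rightarrow> real^'b"
  assumes "sq_integrable_rv \<Omega> X" "sq_integrable_rv \<Omega> Y"
  shows "cross_corr \<Omega> X Y $ i $ j = (\<integral>\<omega>. X \<omega> $ i * Y \<omega> $ j \<partial>\<Omega>)"
proof -
  have "bounded_linear (\<lambda>A::real^'b^'a. A $ i $ j)"
    by (rule bounded_linear_compose[OF bounded_linear_vec_nth bounded_linear_vec_nth])
  from integral_bounded_linear[OF this integrable_outer[OF assms]]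
  show ?thesis by (simp add: cross_corr_def outer_def)
qed

lemma cross_corr_commute:
  assumes "sq_integrable_rv \<Omega> X" "sq_integrable_rv \<Omega> Y"
  shows "cross_corr \<Omega> Y X = transpose (cross_corr \<Omega> X Y)"
  by (simp add: vec_eq_iff transpose_def cross_corr_component assms mult.commute)

lemma cross_corr_add_right:
  fixes X :: "'w \<Rightarrow> real^'a" and Y Z :: "'w \<Rightarrow> real^'b"
  assumes "sq_integrable_rv \<Omega> X" "sq_integrable_rv \<Omega> Y" "sq_integrable_rv \<Omega> Z"
  shows "cross_corr \<Omega> X (\<lambda>\<omega>. Y \<omega> + Z \<omega>) = cross_corr \<Omega> X Y + cross_corr \<Omega> X Z"
proof -
  have "outer u (v + w) = outer u v + outer u w" for u :: "real^'a" and v w :: "real^'b"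
    by (vector outer_def algebra_simps)
  then show ?thesis unfolding cross_corr_def
    by (simp add: Bochner_Integration.integral_add[OF integrable_outer integrable_outer] assms)
qed

lemma cross_corr_mult_left:
  fixes X :: "'w \<Rightarrow> real^'a" and Y :: "'w \<Rightarrow> real^'b" and B :: "real^'a^'c"
  assumes "sq_integrable_rv \<Omega> X" "sq_integrable_rv \<Omega> Y"
  shows "cross_corr \<Omega> (\<lambda>\<omega>. B *v X \<omega>) Y = B ** cross_corr \<Omega> X Y"
proof -
  have "outer (B *v u) v = B ** outer u v" for u :: "real^'a" and v :: "real^'b"
    by (simp add: vec_eq_iff outer_def matrix_matrix_mult_def matrix_vector_mult_def
        sum_distrib_right mult.assoc)
  moreover have "bounded_linear (\<lambda>C :: real^'b^'a. B ** C)"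
    by (intro linear_conv_bounded_linear[THEN iffD1] linearI)
       (simp_all add: matrix_add_ldistrib matrix_scalar_ac scalar_matrix_assoc)
  ultimately show ?thesis unfolding cross_corr_def
    by (simp add: integral_bounded_linear[OF _ integrable_outer[OF assms]])
qed

lemma sq_integrable_rv_mult:
  assumes "sq_integrable_rv \<Omega> X"
  shows "sq_integrable_rv \<Omega> (\<lambda>\<omega>. B *v X \<omega>)"
proof -
  have X: "X \<in> borel_measurable \<Omega>" "integrable \<Omega> (\<lambda>\<omega>. (norm (X \<omega>))\<^sup>2)"
    using assms by (auto simp: sq_integrable_rv_def)
  have meas: "(\<lambda>\<omega>. B *v X \<omega>) \<in> borel_measurable \<Omega>"
    by (rule measurable_compose[OF X(1)])
       (intro borel_measurable_continuous_onI matrix_vector_mult_linear_continuous_on)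
  have "integrable \<Omega> (\<lambda>\<omega>. (norm (B *v X \<omega>))\<^sup>2)"
  proof (rule Bochner_Integration.integrable_bound)
    show "integrable \<Omega> (\<lambda>\<omega>. (onorm ((*v) B))\<^sup>2 * (norm (X \<omega>))\<^sup>2)"
      using X(2) by simp
    show "(\<lambda>\<omega>. (norm (B *v X \<omega>))\<^sup>2) \<in> borel_measurable \<Omega>"
      using meas by measurable
    have "norm (B *v v) \<le> onorm ((*v) B) * norm v" for v
      by (simp add: onorm)
    then show "AE \<omega> in \<Omega>. norm ((norm (B *v X \<omega>))\<^sup>2) \<le> norm ((onorm ((*v) B))\<^sup>2 * (norm (X \<omega>))\<^sup>2)"
      by (simp add: power_mult_distrib[symmetric] power_mono)
  qed
  with meas show ?thesis by (simp add: sq_integrable_rv_def)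
qed

lemma sq_integrable_rv_add:
  assumes "sq_integrable_rv \<Omega> X" "sq_integrable_rv \<Omega> Y"
  shows "sq_integrable_rv \<Omega> (\<lambda>\<omega>. X \<omega> + Y \<omega>)"
proof -
  have X: "X \<in> borel_measurable \<Omega>" "integrable \<Omega> (\<lambda>\<omega>. (norm (X \<omega>))\<^sup>2)"
    and Y: "Y \<in> borel_measurable \<Omega>" "integrable \<Omega> (\<lambda>\<omega>. (norm (Y \<omega>))\<^sup>2)"
    using assms by (auto simp: sq_integrable_rv_def)
  have "integrable \<Omega> (\<lambda>\<omega>. (norm (X \<omega> + Y \<omega>))\<^sup>2)"
  proof (rule Bochner_Integration.integrable_bound)
    show "integrable \<Omega> (\<lambda>\<omega>. 2 * (norm (X \<omega>))\<^sup>2 + 2 * (norm (Y \<omega>))\<^sup>2)"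
      using X(2) Y(2) by simp
    show "(\<lambda>\<omega>. (norm (X \<omega> + Y \<omega>))\<^sup>2) \<in> borel_measurable \<Omega>"
      using X(1) Y(1) by measurable
    have "(norm (u + v))\<^sup>2 \<le> 2 * (norm u)\<^sup>2 + 2 * (norm v)\<^sup>2" for u v :: "real^'b"
    proof -
      have "(norm (u + v))\<^sup>2 + (norm (u - v))\<^sup>2 = 2 * (norm u)\<^sup>2 + 2 * (norm v)\<^sup>2"
        by (simp add: power2_norm_eq_inner algebra_simps inner_commute)
      then show ?thesis using zero_le_power2[of "norm (u - v)"] by linarith
    qed
    then show "AE \<omega> in \<Omega>. norm ((norm (X \<omega> + Y \<omega>))\<^sup>2)
        \<le> norm (2 * (norm (X \<omega>))\<^sup>2 + 2 * (norm (Y \<omega>))\<^sup>2)"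
      by simp
  qed
  with X(1) Y(1) show ?thesis by (simp add: sq_integrable_rv_def)
qed

lemma cross_corr_mult_right:
  assumes X: "sq_integrable_rv \<Omega> X" and Y: "sq_integrable_rv \<Omega> Y"
  shows "cross_corr \<Omega> X (\<lambda>\<omega>. B *v Y \<omega>) = cross_corr \<Omega> X Y ** transpose B"
  by (simp add: cross_corr_commute[OF sq_integrable_rv_mult[OF Y] X] cross_corr_commute[OF Y X]
        cross_corr_mult_left[OF Y X] matrix_transpose_mul)

text \<open>
  Every second moment below is that of a linear image of two uncorrelated vectors, so both the
  measurement covariance and the error covariance are instances of this identity.
\<close>
lemma cross_corr_linear_combination:
  fixes X :: "'w \<Rightarrow> real^'a" and Y :: "'w \<Rightarrow> real^'b"
    and B :: "real^'a^'c" and C :: "real^'b^'c"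
  assumes X: "sq_integrable_rv \<Omega> X" and Y: "sq_integrable_rv \<Omega> Y"
    and XY: "cross_corr \<Omega> X Y = 0"
    and XX: "cross_corr \<Omega> X X = a *\<^sub>R mat 1" and YY: "cross_corr \<Omega> Y Y = b *\<^sub>R mat 1"
  shows "cross_corr \<Omega> (\<lambda>\<omega>. B *v X \<omega> + C *v Y \<omega>) (\<lambda>\<omega>. B *v X \<omega> + C *v Y \<omega>) =
           a *\<^sub>R (B ** transpose B) + b *\<^sub>R (C ** transpose C)"
    and "cross_corr \<Omega> X (\<lambda>\<omega>. B *v X \<omega> + C *v Y \<omega>) = a *\<^sub>R transpose B"
proof -
  let ?Z = "\<lambda>\<omega>. B *v X \<omega> + C *v Y \<omega>"
  note mult = sq_integrable_rv_mult
  have Z: "sq_integrable_rv \<Omega> ?Z"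
    by (intro sq_integrable_rv_add mult X Y)
  have right: "cross_corr \<Omega> U ?Z =
      cross_corr \<Omega> U X ** transpose B + cross_corr \<Omega> U Y ** transpose C"
    if U: "sq_integrable_rv \<Omega> U" for U :: "'w \<Rightarrow> real^'u"
    by (simp add: cross_corr_add_right cross_corr_mult_right U X Y mult)
  have YX: "cross_corr \<Omega> Y X = 0"
    by (simp add: cross_corr_commute[OF X Y] XY transpose_def vec_eq_iff)
  have XZ: "cross_corr \<Omega> X ?Z = a *\<^sub>R transpose B"
    by (simp add: right X XX XY flip: scalar_matrix_assoc)
  have YZ: "cross_corr \<Omega> Y ?Z = b *\<^sub>R transpose C"
    by (simp add: right Y YX YY flip: scalar_matrix_assoc)
  show "cross_corr \<Omega> X ?Z = a *\<^sub>R transpose B" by (fact XZ)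
  have "cross_corr \<Omega> ?Z ?Z = transpose (cross_corr \<Omega> ?Z X ** transpose B) + transpose (cross_corr \<Omega> ?Z Y ** transpose C)"
    by (subst cross_corr_commute[OF Z Z], subst right[OF Z], simp add: transpose_def vec_eq_iff)
  also have "\<dots> = B ** cross_corr \<Omega> X ?Z + C ** cross_corr \<Omega> Y ?Z"
    by (simp add: matrix_transpose_mul transpose_transpose cross_corr_commute[OF X Z] cross_corr_commute[OF Y Z])
  finally show "cross_corr \<Omega> ?Z ?Z = a *\<^sub>R (B ** transpose B) + b *\<^sub>R (C ** transpose C)"
    by (simp add: XZ YZ matrix_scalar_ac scalar_matrix_assoc)
qed

section \<open>The error of a frame under a single erasure\<close>

definition stacked_proj :: "('n::finite \<Rightarrow> (real^'m) set) \<Rightarrow> real^'m^('n \<times> 'm)" where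
  "stacked_proj W = (\<chi> p. orth_proj (W (fst p)) $ snd p)"

definition stacked_noise :: "('n::finite \<Rightarrow> 'w \<Rightarrow> real^'m) \<Rightarrow> 'w \<Rightarrow> real^('n \<times> 'm)" where
  "stacked_noise n \<omega> = (\<chi> p. n (fst p) \<omega> $ snd p)"

lemma measurement_eq: "measurement W x n \<omega> = stacked_proj W *v x \<omega> + stacked_noise n \<omega>"
  by (simp add: vec_eq_iff measurement_def stacked_proj_def stacked_noise_def
      matrix_vector_mul_component)

lemma sq_integrable_stacked_noise:
  fixes n :: "'n::finite \<Rightarrow> 'w \<Rightarrow> real^'m"
  assumes "\<And>i. sq_integrable_rv \<Omega> (n i)"
  shows "sq_integrable_rv \<Omega> (stacked_noise n)"
proof -
  have meas: "n i \<in> borel_measurable \<Omega>" and int: "integrable \<Omega> (\<lambda>\<omega>. (norm (n i \<omega>))\<^sup>2)" for i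
    using assms[of i] by (auto simp: sq_integrable_rv_def)
  have "stacked_noise n \<in> borel_measurable \<Omega>"
  proof (subst borel_measurable_euclidean_space, intro ballI)
    fix e :: "real^('n \<times> 'm)" assume "e \<in> Basis"
    then obtain p where e: "e = axis p 1" by (auto simp: Basis_vec_def)
    have "(\<lambda>\<omega>. n (fst p) \<omega> \<bullet> axis (snd p) 1) \<in> borel_measurable \<Omega>"
      using meas by measurable
    then show "(\<lambda>\<omega>. stacked_noise n \<omega> \<bullet> e) \<in> borel_measurable \<Omega>"
      by (simp add: e inner_axis stacked_noise_def)
  qed
  moreover have "(norm (stacked_noise n \<omega>))\<^sup>2 = (\<Sum>i\<in>UNIV. (norm (n i \<omega>))\<^sup>2)" for \<omega>
    by (simp add: power2_norm_eq_inner inner_vec_def stacked_noise_def sum.cartesian_product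
        flip: UNIV_Times_UNIV) (simp add: case_prod_unfold)
  ultimately show ?thesis using int by (simp add: sq_integrable_rv_def)
qed

text \<open>
  Entry \<open>((i, k), (j, l))\<close> of the stacked moment matrix is entry \<open>(k, l)\<close> of the moment matrix of
  the channels \<open>i\<close> and \<open>j\<close>, so white uncorrelated channels stack to white noise.
\<close>
lemma
  fixes n :: "'n::finite \<Rightarrow> 'w \<Rightarrow> real^'m"
  assumes "measurement_model \<Omega> \<sigma>x \<sigma>n x n"
  shows cross_corr_stacked_noise:
      "cross_corr \<Omega> (stacked_noise n) (stacked_noise n) = \<sigma>n\<^sup>2 *\<^sub>R mat 1"
    and cross_corr_signal_stacked_noise: "cross_corr \<Omega> x (stacked_noise n) = 0"
proof -
  have x: "sq_integrable_rv \<Omega> x" and n: "sq_integrable_rv \<Omega> (n i)"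
    and nn: "cross_corr \<Omega> (n i) (n i) = \<sigma>n\<^sup>2 *\<^sub>R mat 1"
    and nn': "i \<noteq> j \<Longrightarrow> cross_corr \<Omega> (n i) (n j) = 0" and xn: "cross_corr \<Omega> x (n i) = 0" for i j
    using assms by (auto simp: measurement_model_def)
  note noise = sq_integrable_stacked_noise[of \<Omega> n, OF n]
  have "cross_corr \<Omega> (stacked_noise n) (stacked_noise n) $ p $ q =
      cross_corr \<Omega> (n (fst p)) (n (fst q)) $ snd p $ snd q" for p q
    by (simp add: cross_corr_component noise n stacked_noise_def)
  moreover have "cross_corr \<Omega> (n i) (n j) = (if i = j then \<sigma>n\<^sup>2 *\<^sub>R mat 1 else 0)" for i j
    by (simp add: nn nn')
  ultimately show "cross_corr \<Omega> (stacked_noise n) (stacked_noise n) = \<sigma>n\<^sup>2 *\<^sub>R mat 1"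
    by (simp add: vec_eq_iff mat_def prod_eq_iff)
  have "cross_corr \<Omega> x (stacked_noise n) $ k $ q = cross_corr \<Omega> x (n (fst q)) $ k $ snd q" for k q
    by (simp add: cross_corr_component noise n x stacked_noise_def)
  then show "cross_corr \<Omega> x (stacked_noise n) = 0" by (simp add: vec_eq_iff xn)
qed

lemma erasure_complement_mult:
  fixes B :: "real^'k^('n::finite \<times> 'm::finite)"
  shows "((mat 1 - erasure_matrix S) ** B) $ p $ l = (if fst p \<in> S then 0 else B $ p $ l)"
proof -
  have "((mat 1 - erasure_matrix S) ** B) $ p $ l =
      (\<Sum>q\<in>UNIV. if q = p then if fst p \<in> S then 0 else B $ p $ l else 0)"
    unfolding matrix_matrix_mult_def vec_lambda_beta
    by (intro sum.cong) (auto simp: erasure_matrix_def mat_def)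
  then show ?thesis by simp
qed

text \<open>
  For \<open>S = {}\<close> and a tight frame this is a multiple of the identity; for \<open>S = {i}\<close> it governs the estimate after an
  erasure. Each block contributes \<open>P\<^sub>i\<^sup>T P\<^sub>i = P\<^sub>i\<close>.
\<close>
lemma stacked_proj_gram:
  fixes W :: "'n::finite \<Rightarrow> (real^'m) set"
  assumes "\<And>i. subspace (W i)"
  shows "transpose (stacked_proj W) ** (mat 1 - erasure_matrix S) ** stacked_proj W =
    (\<Sum>i\<in>-S. orth_proj (W i))"
proof -
  have "(transpose (stacked_proj W) ** ((mat 1 - erasure_matrix S) ** stacked_proj W)) $ k $ l =
      (\<Sum>i\<in>-S. orth_proj (W i)) $ k $ l" for k l
  proof -
    have "(transpose (stacked_proj W) ** ((mat 1 - erasure_matrix S) ** stacked_proj W)) $ k $ l =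
        (\<Sum>p\<in>UNIV. stacked_proj W $ p $ k * (if fst p \<in> S then 0 else stacked_proj W $ p $ l))"
      by (subst matrix_matrix_mult_def) (simp add: erasure_complement_mult transpose_def)
    also have "\<dots> = (\<Sum>i\<in>UNIV. if i \<notin> S then
        (\<Sum>r\<in>UNIV. orth_proj (W i) $ r $ k * orth_proj (W i) $ r $ l) else 0)"
      by (simp add: stacked_proj_def sum.cartesian_product' case_prod_unfold
          flip: UNIV_Times_UNIV) (auto intro!: sum.cong simp: stacked_proj_def)
    also have "\<dots> = (\<Sum>i\<in>UNIV. if i \<in> -S then
        (transpose (orth_proj (W i)) ** orth_proj (W i)) $ k $ l else 0)"
      by (simp add: matrix_matrix_mult_def transpose_def cong: if_cong)
    also have "\<dots> = (\<Sum>i\<in>-S. orth_proj (W i) $ k $ l)"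
      by (simp add: orth_proj_sym orth_proj_idem assms sum.If_cases Compl_eq)
    finally show ?thesis by simp
  qed
  then show ?thesis by (simp add: vec_eq_iff matrix_mul_assoc)
qed

lemma matrix_inv_right_of_pos_def:
  fixes B :: "real^'k^'k"
  assumes "\<And>v. v \<noteq> 0 \<Longrightarrow> v \<bullet> (B *v v) > 0"
  shows "B ** matrix_inv B = mat 1"
proof -
  have "B *v v = 0 \<Longrightarrow> v = 0" for v using assms[of v] by auto
  then have "\<exists>C. C ** B = mat 1" by (simp add: matrix_left_invertible_ker)
  then have "\<exists>C. B ** C = mat 1 \<and> C ** B = mat 1" using matrix_left_right_inverse by blast
  from someI_ex[OF this] show ?thesis by (simp add: matrix_inv_def)
qed

text \<open>
  With \<open>P\<close> the stacked projections, \<open>P\<^sup>T P = A I\<close> gives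
  \<open>P\<^sup>T (\<sigma>x\<^sup>2 P P\<^sup>T + \<sigma>n\<^sup>2 I) = (A \<sigma>x\<^sup>2 + \<sigma>n\<^sup>2) P\<^sup>T\<close>, so that inverting the covariance of the
  measurement amounts to dividing by a scalar.
\<close>
lemma lmmse_filter_tight:
  fixes W :: "'n::finite \<Rightarrow> (real^'m) set"
  assumes model: "measurement_model \<Omega> \<sigma>x \<sigma>n x n" and W: "\<And>i. subspace (W i)"
    and A: "(\<Sum>i\<in>UNIV. orth_proj (W i)) = A *\<^sub>R mat 1" "A > 0" and \<sigma>n: "\<sigma>n\<^sup>2 > 0"
  shows "lmmse_filter \<Omega> x (measurement W x n) =
    (\<sigma>x\<^sup>2 / (\<sigma>x\<^sup>2 * A + \<sigma>n\<^sup>2)) *\<^sub>R transpose (stacked_proj W)"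
proof -
  let ?P = "stacked_proj W" and ?n = "stacked_noise n" and ?z = "measurement W x n"
  let ?c = "\<sigma>x\<^sup>2 / (\<sigma>x\<^sup>2 * A + \<sigma>n\<^sup>2)"
  have x: "sq_integrable_rv \<Omega> x" and n: "sq_integrable_rv \<Omega> (n i)"
    and xx: "cross_corr \<Omega> x x = \<sigma>x\<^sup>2 *\<^sub>R mat 1" for i
    using model by (auto simp: measurement_model_def)
  have z: "?z = (\<lambda>\<omega>. ?P *v x \<omega> + mat 1 *v ?n \<omega>)" by (simp add: measurement_eq fun_eq_iff)
  note corr = cross_corr_linear_combination[OF x sq_integrable_stacked_noise[of \<Omega> n, OF n]
      cross_corr_signal_stacked_noise[OF model] xx cross_corr_stacked_noise[OF model],
      of ?P "mat 1", folded z]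
  define R where "R = cross_corr \<Omega> ?z ?z"
  have R: "R = \<sigma>x\<^sup>2 *\<^sub>R (?P ** transpose ?P) + \<sigma>n\<^sup>2 *\<^sub>R mat 1"
    using corr(1) by (simp add: R_def)
  have PP: "transpose ?P ** ?P = A *\<^sub>R mat 1"
  proof -
    have "erasure_matrix {} = (0 :: real^('n \<times> 'm)^('n \<times> 'm))"
      by (simp add: erasure_matrix_def vec_eq_iff)
    with stacked_proj_gram[of W "{}", OF W] show ?thesis by (simp add: A)
  qed
  \<comment> \<open>The noise makes the covariance positive definite although \<open>P P\<^sup>T\<close> may be singular.\<close>
  have "v \<bullet> (R *v v) > 0" if "v \<noteq> 0" for v
  proof -
    have "v \<bullet> (?P *v (transpose ?P *v v)) = (transpose ?P *v v) \<bullet> (transpose ?P *v v)"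
      using dot_lmul_matrix[of v ?P "transpose ?P *v v"] by simp
    then have "v \<bullet> (R *v v) = \<sigma>x\<^sup>2 * ((transpose ?P *v v) \<bullet> (transpose ?P *v v)) + \<sigma>n\<^sup>2 * (v \<bullet> v)"
      by (simp add: R matrix_vector_mult_add_rdistrib inner_add_right
          matrix_vector_mul_assoc[symmetric] flip: scaleR_matrix_vector_assoc)
    moreover have "\<sigma>n\<^sup>2 * (v \<bullet> v) > 0" using \<sigma>n that by simp
    ultimately show ?thesis by (simp add: add_nonneg_pos)
  qed
  then have inv: "R ** matrix_inv R = mat 1" by (rule matrix_inv_right_of_pos_def)
  have pos: "\<sigma>x\<^sup>2 * A + \<sigma>n\<^sup>2 > 0" using A(2) \<sigma>n by (simp add: add_nonneg_pos)
  have "transpose ?P ** R = (\<sigma>x\<^sup>2 * A + \<sigma>n\<^sup>2) *\<^sub>R transpose ?P"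
    by (simp add: R matrix_add_ldistrib matrix_scalar_ac PP matrix_mul_assoc scaleR_left_distrib
        flip: scalar_matrix_assoc)
  then have "?c *\<^sub>R transpose ?P ** R = \<sigma>x\<^sup>2 *\<^sub>R transpose ?P"
    using pos by (simp flip: scalar_matrix_assoc)
  also have "\<dots> = cross_corr \<Omega> x ?z" using corr(2) by simp
  finally have "lmmse_filter \<Omega> x ?z = (?c *\<^sub>R transpose ?P ** R) ** matrix_inv R"
    by (simp add: lmmse_filter_def R_def)
  also have "\<dots> = ?c *\<^sub>R transpose ?P"
    by (simp add: matrix_mul_assoc[symmetric] inv)
  finally show ?thesis .
qed

lemma erasure_matrix_complement_idem:
  "(mat 1 - erasure_matrix S) ** (mat 1 - erasure_matrix S) =
    (mat 1 - erasure_matrix S :: real^('n::finite \<times> 'm::finite)^('n \<times> 'm))"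
  by (simp add: vec_eq_iff erasure_complement_mult) (simp add: erasure_matrix_def mat_def)

lemma transpose_erasure_matrix_complement:
  "transpose (mat 1 - erasure_matrix S) = mat 1 - erasure_matrix S"
  by (auto simp: vec_eq_iff transpose_def erasure_matrix_def mat_def)

text \<open>
  Writing \<open>c = \<sigma>x\<^sup>2 / (A \<sigma>x\<^sup>2 + \<sigma>n\<^sup>2)\<close>, the filter applied to the surviving channels has gain
  \<open>c (A I - P\<^sub>i)\<close>. The signal part of the error is therefore \<open>(1 - cA) I + c P\<^sub>i\<close>, the noise part
  has covariance proportional to \<open>c\<^sup>2 (A I - P\<^sub>i)\<close>, and both traces involve \<open>P\<^sub>i\<close> only through
  its trace, the dimension.
\<close>
lemma erasure_mse_single:
  fixes W :: "'n::finite \<Rightarrow> (real^'m) set"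
  assumes model: "measurement_model \<Omega> \<sigma>x \<sigma>n x n" and W: "\<And>i. subspace (W i)"
    and A: "(\<Sum>i\<in>UNIV. orth_proj (W i)) = A *\<^sub>R mat 1" "A > 0" and \<sigma>n: "\<sigma>n\<^sup>2 > 0"
  shows "erasure_mse \<Omega> W x n {i} =
     real CARD('m) * \<sigma>x\<^sup>2 * \<sigma>n\<^sup>2 / (A * \<sigma>x\<^sup>2 + \<sigma>n\<^sup>2)
     + \<sigma>x ^ 4 * (\<sigma>x\<^sup>2 + \<sigma>n\<^sup>2) * real (dim (W i)) / (A * \<sigma>x\<^sup>2 + \<sigma>n\<^sup>2)\<^sup>2"
proof -
  define a where "a = \<sigma>x\<^sup>2"
  define b where "b = \<sigma>n\<^sup>2"
  define c where "c = a / (a * A + b)"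
  define E :: "real^('n \<times> 'm)^('n \<times> 'm)" where "E = mat 1 - erasure_matrix {i}"
  define F where "F = c *\<^sub>R transpose (stacked_proj W)"
  define Q where "Q = orth_proj (W i)"
  let ?P = "stacked_proj W" and ?n = "stacked_noise n"
  have pos: "a * A + b > 0"
    using A(2) \<sigma>n by (simp add: a_def b_def add_nonneg_pos)
  have x: "sq_integrable_rv \<Omega> x" and n: "sq_integrable_rv \<Omega> (n j)"
    and xx: "cross_corr \<Omega> x x = a *\<^sub>R mat 1" for j
    using model by (auto simp: measurement_model_def a_def)
  have F: "lmmse_filter \<Omega> x (measurement W x n) = F"
    unfolding F_def c_def a_def b_def by (rule lmmse_filter_tight[OF model W A \<sigma>n])
  have "(\<Sum>j\<in>-{i}. orth_proj (W j)) = A *\<^sub>R mat 1 - Q"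
    using A(1) by (simp add: Q_def Compl_eq_Diff_UNIV sum_diff1)
  then have gram: "transpose ?P ** E ** ?P = A *\<^sub>R mat 1 - Q"
    using stacked_proj_gram[of W "{i}", OF W] by (simp add: E_def)
  have gain: "F ** E ** ?P = (c * A) *\<^sub>R mat 1 - c *\<^sub>R Q"
    by (simp add: F_def gram scaleR_right_diff_distrib flip: scalar_matrix_assoc)
  define D where "D = (1 - c * A) *\<^sub>R mat 1 + c *\<^sub>R Q"
  have err: "(\<lambda>\<omega>. x \<omega> - erasure_estimate \<Omega> W x n {i} \<omega>) =
      (\<lambda>\<omega>. D *v x \<omega> + (- (F ** E)) *v ?n \<omega>)"
  proof
    fix \<omega>
    have "D = mat 1 - F ** E ** ?P"
      by (simp add: D_def gain algebra_simps)
    then have "D *v x \<omega> = x \<omega> - F *v (E *v (?P *v x \<omega>))"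
      by (simp add: matrix_vector_mult_diff_rdistrib matrix_vector_mul_assoc matrix_mul_assoc)
    moreover have "(- (F ** E)) *v ?n \<omega> = - (F *v (E *v ?n \<omega>))"
      using matrix_vector_mult_diff_rdistrib[of 0 "F ** E" "?n \<omega>"]
      by (simp add: matrix_vector_mul_assoc)
    ultimately show "x \<omega> - erasure_estimate \<Omega> W x n {i} \<omega> = D *v x \<omega> + (- (F ** E)) *v ?n \<omega>"
      by (simp add: erasure_estimate_def F measurement_eq matrix_vector_right_distrib
          flip: E_def)
  qed
  have QQ: "Q ** Q = Q" and QT: "transpose Q = Q" and trQ: "trace Q = real (dim (W i))"
    by (simp_all add: Q_def orth_proj_idem orth_proj_sym trace_orth_proj W)
  have "transpose D = D"
    using QT by (simp add: D_def vec_eq_iff transpose_def mat_def eq_commute)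
  moreover have "(u *\<^sub>R mat 1 + c *\<^sub>R Q) ** (u *\<^sub>R mat 1 + c *\<^sub>R Q) =
      u\<^sup>2 *\<^sub>R mat 1 + (2 * u * c + c\<^sup>2) *\<^sub>R Q" for u
    by (simp add: matrix_add_ldistrib matrix_add_rdistrib matrix_scalar_ac QQ algebra_simps
        power2_eq_square flip: scalar_matrix_assoc) (simp add: vec_eq_iff)
  ultimately have "D ** transpose D =
      (1 - c * A)\<^sup>2 *\<^sub>R mat 1 + (2 * (1 - c * A) * c + c\<^sup>2) *\<^sub>R Q"
    by (simp only: D_def)
  then have trD: "trace (D ** transpose D) =
      (1 - c * A)\<^sup>2 * real CARD('m) + (2 * (1 - c * A) * c + c\<^sup>2) * real (dim (W i))"
    by (simp add: trace_add trace_scaleR trace_I trQ)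
  have "(- (F ** E)) ** transpose (- (F ** E)) = F ** E ** transpose (F ** E)"
    by (simp add: vec_eq_iff matrix_matrix_mult_def[of "- _"] matrix_matrix_mult_def[of "_ ** _"] transpose_def)
  also have "\<dots> = F ** (E ** E) ** transpose F"
    by (simp add: matrix_transpose_mul matrix_mul_assoc E_def transpose_erasure_matrix_complement)
  also have "\<dots> = c\<^sup>2 *\<^sub>R (transpose ?P ** E ** ?P)"
    by (simp add: E_def erasure_matrix_complement_idem F_def transpose_scalar matrix_scalar_ac power2_eq_square flip: scalar_matrix_assoc)
  finally have trF: "trace ((- (F ** E)) ** transpose (- (F ** E))) =
      c\<^sup>2 * (A * real CARD('m) - real (dim (W i)))"
    by (simp add: gram trace_scaleR trace_sub trace_I trQ)
  have "erasure_mse \<Omega> W x n {i} = a * trace (D ** transpose D)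
      + b * trace ((- (F ** E)) ** transpose (- (F ** E)))"
    unfolding erasure_mse_def err
    by (subst cross_corr_linear_combination(1)[OF x sq_integrable_stacked_noise[of \<Omega> n, OF n]
      cross_corr_signal_stacked_noise[OF model] xx
      cross_corr_stacked_noise[OF model, folded b_def]])
      (simp add: trace_add trace_scaleR)
  also have "\<dots> = real CARD('m) * (a * (1 - c * A)\<^sup>2 + b * c\<^sup>2 * A)
      + (a * (2 * (1 - c * A) * c + c\<^sup>2) - b * c\<^sup>2) * real (dim (W i))"
    unfolding trD trF by (simp add: algebra_simps)
  also have "1 - c * A = b / (a * A + b)"
    using pos by (simp add: c_def field_simps)
  also have "a * (b / (a * A + b))\<^sup>2 + b * c\<^sup>2 * A = a * b / (a * A + b)"
  proof -
    have "a * (b / (a * A + b))\<^sup>2 + b * c\<^sup>2 * A = (a * b * b + a * b * (a * A)) / (a * A + b)\<^sup>2"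
      by (simp add: c_def power_divide add_divide_distrib power2_eq_square mult_ac)
    also have "a * b * b + a * b * (a * A) = a * b * (a * A + b)"
      by (simp add: algebra_simps)
    finally show ?thesis using pos by (simp add: power2_eq_square)
  qed
  also have "a * (2 * (b / (a * A + b)) * c + c\<^sup>2) - b * c\<^sup>2 = a\<^sup>2 * (a + b) / (a * A + b)\<^sup>2"
    using pos by (simp add: c_def divide_simps) (simp add: algebra_simps power2_eq_square)
  finally show ?thesis
    by (simp add: a_def b_def mult_ac flip: power_mult)
qed

section \<open>The mean-squared error as a function of the dimension\<close>

text \<open>
  In the variable \<open>t = 1 / (N m \<sigma>x\<^sup>2 / M + \<sigma>n\<^sup>2)\<close> the function is a concave quadratic
  polynomial; this is its vertex form, and \<open>m_tilde\<close> is the dimension belonging to the vertex.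
\<close>
lemma mse_fun_vertex_form:
  fixes \<sigma>x \<sigma>n :: real and M N :: nat
  defines "d \<equiv> \<lambda>m. real N * m * \<sigma>x\<^sup>2 / real M + \<sigma>n\<^sup>2"
  assumes pos: "M > 0" "N > 0" "\<sigma>x\<^sup>2 > 0" "\<sigma>n\<^sup>2 > 0" and m: "d m > 0"
  shows "d (m_tilde M N \<sigma>x \<sigma>n) > 0"
    and "mse_fun M N \<sigma>x \<sigma>n m = mse_fun M N \<sigma>x \<sigma>n (m_tilde M N \<sigma>x \<sigma>n)
      - (real M * \<sigma>x\<^sup>2 * (\<sigma>x\<^sup>2 + \<sigma>n\<^sup>2) * \<sigma>n\<^sup>2 / real N)
        * (1 / d m - 1 / d (m_tilde M N \<sigma>x \<sigma>n))\<^sup>2"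
proof -
  let ?mt = "m_tilde M N \<sigma>x \<sigma>n"
  define a where "a = \<sigma>x\<^sup>2"
  define b where "b = \<sigma>n\<^sup>2"
  define p where "p = real M"
  define q where "q = real N"
  have sq: "\<sigma>x ^ 4 = a\<^sup>2" "\<sigma>n ^ 4 = b\<^sup>2" by (simp_all add: a_def b_def flip: power_mult)
  have ab: "a > 0" "b > 0" "p > 0" "q > 0" "a + b > 0"
    using pos by (auto simp: a_def b_def p_def q_def intro: add_pos_pos)
  have s: "(q + 1) * b + a > 0" using ab by (intro add_pos_pos mult_pos_pos) auto
  have mt: "?mt = p / q * ((a * b - (q - 1) * b\<^sup>2) / (a * ((q + 1) * b + a)))"
    by (simp add: m_tilde_def sq a_def[symmetric] b_def[symmetric] p_def q_def)
  have "d ?mt = (a * b - (q - 1) * b\<^sup>2) / ((q + 1) * b + a) + b"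
    using ab s unfolding d_def mt a_def[symmetric] b_def[symmetric] p_def[symmetric] q_def[symmetric]
    by simp
  also have "\<dots> = 2 * (a + b) * b / ((q + 1) * b + a)"
    using s by (simp add: field_simps power2_eq_square)
  finally have dt: "d ?mt = 2 * (a + b) * b / ((q + 1) * b + a)" .
  show dpos: "d ?mt > 0" unfolding dt using ab s by simp
  have quad: "mse_fun M N \<sigma>x \<sigma>n k =
      p * a / q * ((b * (q + 1) + a) * (1 / d k) - (a + b) * b * (1 / d k)\<^sup>2)"
    if k: "d k > 0" for k
  proof -
    have dk: "d k = q * k * a / p + b" by (simp add: d_def a_def b_def p_def q_def)
    have keq: "k = p / (q * a) * (d k - b)" using ab by (simp add: dk field_simps)
    have "mse_fun M N \<sigma>x \<sigma>n k = p * a * b / d k + a\<^sup>2 * (a + b) * k / (d k)\<^sup>2"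
      by (simp add: mse_fun_def d_def a_def b_def p_def q_def flip: power_mult)
    also have "\<dots> = p * a * b / d k + a\<^sup>2 * (a + b) * (p / (q * a) * (d k - b)) / (d k)\<^sup>2"
      using keq by simp
    also have "\<dots> = p * a / q * ((b * (q + 1) + a) * (1 / d k) - (a + b) * b * (1 / d k)\<^sup>2)"
      using ab k by (simp add: field_simps power2_eq_square)
    finally show ?thesis .
  qed
  \<comment> \<open>The vertex of \<open>u t - w t\<^sup>2\<close> is the point \<open>t\<^sub>0\<close> with \<open>u = 2 w t\<^sub>0\<close>.\<close>
  have lin: "b * (q + 1) + a = 2 * (a + b) * b * (1 / d ?mt)"
  proof -
    have "2 * (a + b) * b \<noteq> 0" using ab by simp
    then show ?thesis unfolding dt by (simp add: mult.commute)
  qed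
  have square: "p * a / q * (2 * (a + b) * b * T * t - (a + b) * b * t\<^sup>2) =
      p * a / q * (2 * (a + b) * b * T * T - (a + b) * b * T\<^sup>2)
      - p * a * (a + b) * b / q * (t - T)\<^sup>2" for t T
    using ab by (simp add: field_simps power2_eq_square)
  show "mse_fun M N \<sigma>x \<sigma>n m = mse_fun M N \<sigma>x \<sigma>n ?mt
      - (real M * \<sigma>x\<^sup>2 * (\<sigma>x\<^sup>2 + \<sigma>n\<^sup>2) * \<sigma>n\<^sup>2 / real N) * (1 / d m - 1 / d ?mt)\<^sup>2"
    unfolding quad[OF m] quad[OF dpos] lin
    unfolding a_def[symmetric] b_def[symmetric] p_def[symmetric] q_def[symmetric]
    by (rule square)
qed

text \<open>
  The denominator \<open>d m = N m \<sigma>x\<^sup>2 / M + \<sigma>n\<^sup>2\<close> increases with \<open>m\<close> and is positive exactly on the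
  stated domain. In the vertex form the values are therefore ordered by the distance of \<open>1 / d m\<close>
  from the vertex.
\<close>
lemma
  fixes \<sigma>x \<sigma>n :: real and M N :: nat
  assumes pos: "M > 0" "N > 0" "\<sigma>x\<^sup>2 > 0" "\<sigma>n\<^sup>2 > 0"
  shows m_tilde_in_domain:
      "m_tilde M N \<sigma>x \<sigma>n > - (real M * \<sigma>n\<^sup>2 / (real N * \<sigma>x\<^sup>2))"
    and mse_fun_less_max:
      "\<lbrakk>m > - (real M * \<sigma>n\<^sup>2 / (real N * \<sigma>x\<^sup>2)); m \<noteq> m_tilde M N \<sigma>x \<sigma>n\<rbrakk> \<Longrightarrow>
        mse_fun M N \<sigma>x \<sigma>n m < mse_fun M N \<sigma>x \<sigma>n (m_tilde M N \<sigma>x \<sigma>n)"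
    and mse_fun_mono_below:
      "\<lbrakk>0 \<le> m; m \<le> m'; m' \<le> m_tilde M N \<sigma>x \<sigma>n\<rbrakk> \<Longrightarrow>
        mse_fun M N \<sigma>x \<sigma>n m \<le> mse_fun M N \<sigma>x \<sigma>n m'"
    and mse_fun_antimono_above:
      "\<lbrakk>0 \<le> m; m_tilde M N \<sigma>x \<sigma>n \<le> m; m \<le> m'\<rbrakk> \<Longrightarrow>
        mse_fun M N \<sigma>x \<sigma>n m' \<le> mse_fun M N \<sigma>x \<sigma>n m"
proof -
  let ?mt = "m_tilde M N \<sigma>x \<sigma>n"
  define d where "d = (\<lambda>m. real N * m * \<sigma>x\<^sup>2 / real M + \<sigma>n\<^sup>2)"
  define K where "K = real M * \<sigma>x\<^sup>2 * (\<sigma>x\<^sup>2 + \<sigma>n\<^sup>2) * \<sigma>n\<^sup>2 / real N"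
  have K: "K > 0" unfolding K_def using pos by (intro divide_pos_pos mult_pos_pos add_pos_pos) auto
  have dom: "m > - (real M * \<sigma>n\<^sup>2 / (real N * \<sigma>x\<^sup>2)) \<longleftrightarrow> d m > 0" for m
  proof -
    have "real M / (real N * \<sigma>x\<^sup>2) > 0" using pos by simp
    then have "d m > 0 \<longleftrightarrow> d m * (real M / (real N * \<sigma>x\<^sup>2)) > 0"
      by (metis mult_pos_pos zero_less_mult_pos2)
    also have "d m * (real M / (real N * \<sigma>x\<^sup>2)) = m + real M * \<sigma>n\<^sup>2 / (real N * \<sigma>x\<^sup>2)"
      using pos by (simp add: d_def field_simps)
    finally show ?thesis by linarith
  qed
  have mono: "d m \<le> d m' \<longleftrightarrow> m \<le> m'" for m m'
    using pos by (simp add: d_def divide_le_cancel)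
  have d0: "d m > 0" if "m \<ge> 0" for m
    using pos that by (simp add: d_def add_nonneg_pos)
  have dt: "d ?mt > 0"
    using mse_fun_vertex_form(1)[OF pos, of 0] d0[of 0] unfolding d_def by blast
  have vertex: "mse_fun M N \<sigma>x \<sigma>n k =
      mse_fun M N \<sigma>x \<sigma>n ?mt - K * (1 / d k - 1 / d ?mt)\<^sup>2" if "d k > 0" for k
    using mse_fun_vertex_form(2)[OF pos, of k] that unfolding d_def K_def by blast
  show "?mt > - (real M * \<sigma>n\<^sup>2 / (real N * \<sigma>x\<^sup>2))" using dt by (simp only: dom)
  show "mse_fun M N \<sigma>x \<sigma>n m < mse_fun M N \<sigma>x \<sigma>n ?mt"
    if "m > - (real M * \<sigma>n\<^sup>2 / (real N * \<sigma>x\<^sup>2))" "m \<noteq> ?mt"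
  proof -
    have dm: "d m > 0" using that(1) dom by simp
    have "d m \<noteq> d ?mt" using mono[of m ?mt] mono[of ?mt m] that(2) by auto
    then have "1 / d m - 1 / d ?mt \<noteq> 0" using dm dt by simp
    then have "K * (1 / d m - 1 / d ?mt)\<^sup>2 > 0" using K by simp
    then show ?thesis using vertex[OF dm] by linarith
  qed
  have cmp: "mse_fun M N \<sigma>x \<sigma>n k \<le> mse_fun M N \<sigma>x \<sigma>n k'"
    if "d k > 0" "d k' > 0" "\<bar>1 / d k' - 1 / d ?mt\<bar> \<le> \<bar>1 / d k - 1 / d ?mt\<bar>" for k k'
    using K that(3) by (simp add: vertex[OF that(1)] vertex[OF that(2)] abs_le_square_iff)
  have anti: "1 / d k' \<le> 1 / d k" if "k \<le> k'" "d k > 0" for k k'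
    using that mono[of k k'] by (simp add: frac_le)
  show "mse_fun M N \<sigma>x \<sigma>n m \<le> mse_fun M N \<sigma>x \<sigma>n m'" if "0 \<le> m" "m \<le> m'" "m' \<le> ?mt"
    using that by (intro cmp) (use d0 anti[of m m'] anti[of m' ?mt] in auto)
  show "mse_fun M N \<sigma>x \<sigma>n m' \<le> mse_fun M N \<sigma>x \<sigma>n m" if "0 \<le> m" "?mt \<le> m" "m \<le> m'"
    using that dt by (intro cmp) (use d0 anti[of m m'] anti[of ?mt m] in auto)
qed

text \<open>
  Since the function increases up to \<open>m_tilde\<close> and decreases afterwards, on an interval it is
  smallest at an end point; \<open>m_star\<close> picks the better one.
\<close>
lemma mse_fun_m_star_le:
  fixes \<sigma>x \<sigma>n :: real and M N :: nat
  assumes pos: "M > 0" "N > 0" "\<sigma>x\<^sup>2 > 0" "\<sigma>n\<^sup>2 > 0"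
    and m: "m_min \<le> m" "m \<le> m_max"
  shows "mse_fun M N \<sigma>x \<sigma>n (real (m_star M N \<sigma>x \<sigma>n m_min m_max)) \<le> mse_fun M N \<sigma>x \<sigma>n (real m)"
proof -
  let ?mt = "m_tilde M N \<sigma>x \<sigma>n" and ?f = "\<lambda>k. mse_fun M N \<sigma>x \<sigma>n (real k)"
  have up: "?f m_min \<le> ?f m" if "real m \<le> ?mt"
    using mse_fun_mono_below[OF pos _ _ that, of "real m_min"] m(1) by simp
  have down: "?f m_max \<le> ?f m" if "?mt \<le> real m"
    using mse_fun_antimono_above[OF pos _ that, of "real m_max"] m(2) by simp
  show ?thesis
    using up down m by (cases "real m \<le> ?mt") (auto simp: m_star_def)
qed

section \<open>Optimal dimensions\<close>

text \<open>The frame bound \<open>A\<close> is determined by comparing traces in \<open>\<Sum>\<^sub>i P\<^sub>i = A I\<close>.\<close>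
lemma tight_frame_bound:
  fixes W :: "'n::finite \<Rightarrow> (real^'m) set"
  assumes W: "\<And>i. subspace (W i)" and A: "(\<Sum>i\<in>UNIV. orth_proj (W i)) = A *\<^sub>R mat 1"
  shows "A = real (\<Sum>i\<in>UNIV. dim (W i)) / real CARD('m)"
proof -
  have "(\<Sum>i\<in>UNIV. trace (orth_proj (W i))) = trace (A *\<^sub>R mat 1 :: real^'m^'m)"
    by (simp add: trace_sum flip: A)
  then have "real (\<Sum>i\<in>UNIV. dim (W i)) = A * real CARD('m)"
    by (simp add: trace_orth_proj W trace_scaleR trace_I)
  then show ?thesis by (simp add: field_simps)
qed

text \<open>
  A unit vector \<open>v\<close> of \<open>W\<^sub>i\<close> satisfies \<open>A = \<Sum>\<^sub>j \<parallel>P\<^sub>j v\<parallel>\<^sup>2 \<ge> \<parallel>P\<^sub>i v\<parallel>\<^sup>2 = 1\<close>. By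
  \<open>tight_frame_bound\<close> the dimensions then add up to at least that of the ambient space.
\<close>
lemma tight_frame_bound_ge_1:
  fixes W :: "'n::finite \<Rightarrow> (real^'m) set"
  assumes W: "\<And>i. subspace (W i)" and A: "(\<Sum>i\<in>UNIV. orth_proj (W i)) = A *\<^sub>R mat 1"
    and i: "dim (W i) \<noteq> 0"
  shows "A \<ge> 1"
proof -
  obtain v where v: "v \<in> W i" "v \<noteq> 0" using i by (auto simp: dim_eq_0)
  have "v \<bullet> v = (orth_proj (W i) *v v) \<bullet> (orth_proj (W i) *v v)"
    by (simp add: orth_proj_fixes W v)
  also have "\<dots> \<le> (\<Sum>j\<in>UNIV. (orth_proj (W j) *v v) \<bullet> (orth_proj (W j) *v v))"
    by (intro member_le_sum) auto
  also have "\<dots> = v \<bullet> ((\<Sum>j\<in>UNIV. orth_proj (W j)) *v v)"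
    by (simp add: sum_matrix_vector_mult inner_sum_right inner_orth_proj[OF W, symmetric])
  also have "\<dots> = A * (v \<bullet> v)"
    by (simp add: A flip: scaleR_matrix_vector_assoc)
  finally show ?thesis using v(2) by simp
qed

text \<open>
  The error decreases when the total dimension grows while \<open>dim (W i)\<close> stays fixed. Hence, among
  frames of prescribed largest dimension, it is bounded below by the value for equal dimensions.
\<close>
lemma one_erasure_mse_ge:
  fixes W :: "'n::finite \<Rightarrow> (real^'m) set"
  assumes model: "measurement_model \<Omega> \<sigma>x \<sigma>n x n" and frame: "tight_fusion_frame W"
    and \<sigma>: "\<sigma>x\<^sup>2 > 0" "\<sigma>n\<^sup>2 > 0"
  shows "mse_fun CARD('m) CARD('n) \<sigma>x \<sigma>n (real (Max (range (\<lambda>i. dim (W i))))) \<le>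
    one_erasure_mse \<Omega> W x n"
proof -
  obtain A where W: "\<And>i. subspace (W i)"
    and A: "(\<Sum>i\<in>UNIV. orth_proj (W i)) = A *\<^sub>R mat 1" "A > 0"
    using frame by (auto simp: tight_fusion_frame_def)
  define m where "m = Max (range (\<lambda>i. dim (W i)))"
  have "m \<in> range (\<lambda>i. dim (W i))" unfolding m_def by (intro Max_in) auto
  then obtain i where i: "dim (W i) = m" by auto
  have "dim (W j) \<le> m" for j unfolding m_def by (intro Max_ge) auto
  then have "(\<Sum>j\<in>UNIV. dim (W j)) \<le> CARD('n) * m"
    using sum_bounded_above[of UNIV "\<lambda>j. dim (W j)" m] by simp
  then have "real (\<Sum>j\<in>UNIV. dim (W j)) \<le> real CARD('n) * real m"
    by (metis of_nat_le_iff of_nat_mult)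
  then have "A \<le> real CARD('n) * real m / real CARD('m)"
    unfolding tight_frame_bound[OF W A(1)] by (intro divide_right_mono) auto
  then have le: "A * \<sigma>x\<^sup>2 + \<sigma>n\<^sup>2 \<le> real CARD('n) * real m * \<sigma>x\<^sup>2 / real CARD('m) + \<sigma>n\<^sup>2"
    using mult_right_mono[of A _ "\<sigma>x\<^sup>2"] by fastforce
  have pos: "A * \<sigma>x\<^sup>2 + \<sigma>n\<^sup>2 > 0" using A(2) \<sigma> by (simp add: add_pos_pos)
  have "mse_fun CARD('m) CARD('n) \<sigma>x \<sigma>n (real m) \<le> erasure_mse \<Omega> W x n {i}"
  proof -
    let ?D = "real CARD('n) * real m * \<sigma>x\<^sup>2 / real CARD('m) + \<sigma>n\<^sup>2"
    have D: "?D > 0" using le pos by linarith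
    have "c / ?D \<le> c / (A * \<sigma>x\<^sup>2 + \<sigma>n\<^sup>2)" if "c \<ge> 0" for c
      using le that by (rule divide_left_mono) (use pos D in simp)
    moreover have "c / ?D\<^sup>2 \<le> c / (A * \<sigma>x\<^sup>2 + \<sigma>n\<^sup>2)\<^sup>2" if "c \<ge> 0" for c
      using power_mono[OF le less_imp_le[OF pos]] that
      by (rule divide_left_mono) (use pos D in simp)
    ultimately show ?thesis
      unfolding mse_fun_def erasure_mse_single[OF model W A \<sigma>(2)] i
      by (intro add_mono) simp_all
  qed
  also have "\<dots> \<le> one_erasure_mse \<Omega> W x n"
    unfolding one_erasure_mse_def by (intro Max_ge) auto
  finally show ?thesis by (simp add: m_def)
qed

lemma one_erasure_mse_equidimensional:
  fixes W :: "'n::finite \<Rightarrow> (real^'m) set"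
  assumes model: "measurement_model \<Omega> \<sigma>x \<sigma>n x n" and frame: "tight_fusion_frame W"
    and \<sigma>n: "\<sigma>n\<^sup>2 > 0" and dim: "\<And>i. dim (W i) = m"
  shows "one_erasure_mse \<Omega> W x n = mse_fun CARD('m) CARD('n) \<sigma>x \<sigma>n (real m)"
proof -
  obtain A where W: "\<And>i. subspace (W i)"
    and A: "(\<Sum>i\<in>UNIV. orth_proj (W i)) = A *\<^sub>R mat 1" "A > 0"
    using frame by (auto simp: tight_fusion_frame_def)
  have "A = real CARD('n) * real m / real CARD('m)"
    using tight_frame_bound[OF W A(1)] by (simp add: dim)
  then have "erasure_mse \<Omega> W x n {i} = mse_fun CARD('m) CARD('n) \<sigma>x \<sigma>n (real m)" for i
    unfolding erasure_mse_single[OF model W A \<sigma>n] by (simp add: mse_fun_def dim)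
  then show ?thesis by (simp add: one_erasure_mse_def)
qed

theorem theorem3p1:
  fixes M N m_min m_max :: nat and \<sigma>x \<sigma>n :: real
    and \<Omega> :: "'w measure" and x :: "'w \<Rightarrow> real^'m" and n :: "'n::finite \<Rightarrow> 'w \<Rightarrow> real^'m"
  assumes "M = CARD('m)" and "N = CARD('n)"
    and "\<sigma>x\<^sup>2 > 0" and "\<sigma>n\<^sup>2 > 0"
    and "m_min = nat \<lceil>real M / real N\<rceil>"
    and "m_min \<le> m_max" and "m_max \<le> M"
    and "measurement_model \<Omega> \<sigma>x \<sigma>n x n"
  shows "m_tilde M N \<sigma>x \<sigma>n > - (real M * \<sigma>n\<^sup>2 / (real N * \<sigma>x\<^sup>2)) \<and>
     (\<forall>m::real. m > - (real M * \<sigma>n\<^sup>2 / (real N * \<sigma>x\<^sup>2)) \<and> m \<noteq> m_tilde M N \<sigma>x \<sigma>n \<longrightarrow>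
        mse_fun M N \<sigma>x \<sigma>n m < mse_fun M N \<sigma>x \<sigma>n (m_tilde M N \<sigma>x \<sigma>n)) \<and>
     (\<forall>(W' :: 'n \<Rightarrow> (real^'m) set) (W :: 'n \<Rightarrow> (real^'m) set).
        tight_fusion_frame W' \<and> (\<forall>i. dim (W' i) = m_star M N \<sigma>x \<sigma>n m_min m_max) \<and>
        tight_fusion_frame W \<and> (\<forall>i. dim (W i) \<in> {1..m_max}) \<longrightarrow>
        one_erasure_mse \<Omega> W' x n \<le> one_erasure_mse \<Omega> W x n)"
proof -
  have pos: "M > 0" "N > 0" "\<sigma>x\<^sup>2 > 0" "\<sigma>n\<^sup>2 > 0" using assms by auto
  note model = assms(8)
  have "one_erasure_mse \<Omega> W' x n \<le> one_erasure_mse \<Omega> W x n"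
    if W': "tight_fusion_frame W'" "\<And>i. dim (W' i) = m_star M N \<sigma>x \<sigma>n m_min m_max"
      and W: "tight_fusion_frame W" "\<And>i. dim (W i) \<in> {1..m_max}"
    for W' W :: "'n \<Rightarrow> (real^'m) set"
  proof -
    define m where "m = Max (range (\<lambda>i. dim (W i)))"
    have "m \<in> range (\<lambda>i. dim (W i))" unfolding m_def by (intro Max_in) auto
    then have "m \<le> m_max" using W(2) by auto
    obtain A where sub: "\<And>i. subspace (W i)"
      and A: "(\<Sum>i\<in>UNIV. orth_proj (W i)) = A *\<^sub>R mat 1"
      using W(1) by (auto simp: tight_fusion_frame_def)
    \<comment> \<open>The index is arbitrary: every subspace is nonzero.\<close>
    have "dim (W undefined) \<noteq> 0"
      using W(2)[of undefined] by (metis atLeastAtMost_iff not_one_le_zero)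
    then have "A \<ge> 1" by (rule tight_frame_bound_ge_1[OF sub A])
    then have "real M \<le> real (\<Sum>i\<in>UNIV. dim (W i))"
      using tight_frame_bound[OF sub A] pos(1) by (simp add: assms(1))
    moreover have "dim (W i) \<le> m" for i unfolding m_def by (intro Max_ge) auto
    then have "(\<Sum>i\<in>UNIV. dim (W i)) \<le> N * m"
      using sum_bounded_above[of UNIV "\<lambda>i. dim (W i)" m] by (simp add: assms(2))
    ultimately have "real M \<le> real N * real m"
      by (metis of_nat_le_iff of_nat_mult order_trans)
    then have "real M / real N \<le> real m" using pos(2) by (simp add: field_simps)
    then have "m_min \<le> m" unfolding assms(5) by (simp add: ceiling_le_iff)
    have "one_erasure_mse \<Omega> W' x n = mse_fun M N \<sigma>x \<sigma>n (real (m_star M N \<sigma>x \<sigma>n m_min m_max))"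
      using one_erasure_mse_equidimensional[OF model W'(1) pos(4) W'(2)] by (simp add: assms(1,2))
    also have "\<dots> \<le> mse_fun M N \<sigma>x \<sigma>n (real m)"
      by (rule mse_fun_m_star_le[OF pos \<open>m_min \<le> m\<close> \<open>m \<le> m_max\<close>])
    also have "\<dots> \<le> one_erasure_mse \<Omega> W x n"
      using one_erasure_mse_ge[OF model W(1) pos(3,4)] by (simp add: m_def assms(1,2))
    finally show ?thesis .
  qed
  then show ?thesis
    using m_tilde_in_domain[OF pos] mse_fun_less_max[OF pos] by blast
qed

end
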